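(* Let $\Sigma$ be a finite set. There is a (randomized) algorithm which, given subcube-conditioning ($\mathsf{SUBCOND}$) oracle access to two distributions $\mathcal{P}$ and $\mathcal{Q}$ over $\Sigma^n$, and parameters $\varepsilon_2\in(0,1]$ and $\varepsilon_1\in[0,\varepsilon_2)$, makes at most $\tilde{O}\left(n^3|\Sigma|/(\varepsilon_2-\varepsilon_1)^5\right)$ oracle queries and, with probability at least $3/5$, outputs Accept if $d_{TV}(\mathcal{P},\mathcal{Q})<\varepsilon_1$ and outputs Reject if $d_{TV}(\mathcal{P},\mathcal{Q})>\varepsilon_2$.
   Context: For a query string $\rho\in(\Sigma\cup\{*\})^n$, the subcube $S_\rho$ is the set of $w\in\Sigma^n$ with $w[i]=\rho[i]$ for every $i$ with $\rho[i]\neq *$. For a distribution $\mathcal{D}$ on $\Sigma^n$, $\mathcal{D}_\rho(w)=\mathcal{D}(w)/\mathcal{D}(S_\rho)$ for $w\in S_\rho$. A $\mathsf{SUBCOND}$ oracle for $\mathcal{D}$ takes any $\rho\in(\Sigma\cup\{*\})^n$ and returns an independent sample $w\sim\mathcal{D}_\rho$. $d_{TV}(\mathcal{D}_1,\mathcal{D}_2)=\frac12\sum_{\sigma\in\Sigma^n}|\mathcal{D}_1(\sigma)-\mathcal{D}_2(\sigma)|$. $\tilde{O}$ hides polylogarithmic factors. *)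

theory Defs
  imports "HOL-Probability.Probability"
begin

definition words :: "'a set \<Rightarrow> nat \<Rightarrow> 'a list set" where
  "words \<Sigma> n = {w. set w \<subseteq> \<Sigma> \<and> length w = n}"

text \<open>In a query string, \<open>None\<close> plays the role of the symbol \<open>*\<close>.\<close>

type_synonym 'a query = "'a option list"

definition queries :: "'a set \<Rightarrow> nat \<Rightarrow> 'a query set" where
  "queries \<Sigma> n = {\<rho>. set \<rho> \<subseteq> insert None (Some ` \<Sigma>) \<and> length \<rho> = n}"

definition subcube :: "'a set \<Rightarrow> nat \<Rightarrow> 'a query \<Rightarrow> 'a list set" where
  "subcube \<Sigma> n \<rho> = {w \<in> words \<Sigma> n. \<forall>i<n. \<rho> ! i \<noteq> None \<longrightarrow> \<rho> ! i = Some (w ! i)}"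

text \<open>
  An oracle maps each query to the distribution of its answer; every call draws a fresh,
  independent sample. The conditional distribution is undefined on subcubes of mass zero. There
  the answer may follow any distribution on words, so that a statement about all oracles for
  \<open>D\<close> covers every convention that returns a word. Nothing is assumed about ill-formed queries.
\<close>

type_synonym 'a oracle_fun = "'a query \<Rightarrow> 'a list pmf"

definition subcond_oracle ::
    "'a set \<Rightarrow> nat \<Rightarrow> 'a list pmf \<Rightarrow> 'a oracle_fun \<Rightarrow> bool" where
  "subcond_oracle \<Sigma> n D orc \<longleftrightarrow>
     (\<forall>\<rho>\<in>queries \<Sigma> n.
        set_pmf (orc \<rho>) \<subseteq> words \<Sigma> n \<and>
        (measure_pmf.prob D (subcube \<Sigma> n \<rho>) > 0 \<longrightarrow> orc \<rho> = cond_pmf D (subcube \<Sigma> n \<rho>)))"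

definition d_TV :: "'a set \<Rightarrow> nat \<Rightarrow> 'a list pmf \<Rightarrow> 'a list pmf \<Rightarrow> real" where
  "d_TV \<Sigma> n P Q = 1 / 2 * (\<Sum>w\<in>words \<Sigma> n. \<bar>pmf P w - pmf Q w\<bar>)"

datatype verdict = Accept | Reject

text \<open>
  A randomized adaptive algorithm with access to an oracle for \<open>P\<close> and one for \<open>Q\<close>, as a
  well-founded decision tree: it stops with a verdict, tosses a fair coin, or queries one of the
  oracles and continues depending on the answer.
\<close>

datatype 'a tester =
    Output verdict
  | Toss "'a tester" "'a tester"
  | Query_P "'a query" "'a list \<Rightarrow> 'a tester"
  | Query_Q "'a query" "'a list \<Rightarrow> 'a tester"

text \<open>The joint distribution of the verdict and the number of oracle queries made.\<close>

primrec run :: "'a oracle_fun \<Rightarrow> 'a oracle_fun \<Rightarrow> 'a tester \<Rightarrow> (verdict \<times> nat) pmf" where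
  "run oP oQ (Output v) = return_pmf (v, 0)"
| "run oP oQ (Toss t u) =
     bind_pmf (bernoulli_pmf (1 / 2)) (\<lambda>b. if b then run oP oQ t else run oP oQ u)"
| "run oP oQ (Query_P \<rho> k) =
     bind_pmf (oP \<rho>) (\<lambda>w. map_pmf (map_prod id Suc) (run oP oQ (k w)))"
| "run oP oQ (Query_Q \<rho> k) =
     bind_pmf (oQ \<rho>) (\<lambda>w. map_pmf (map_prod id Suc) (run oP oQ (k w)))"

definition verdict_prob :: "'a oracle_fun \<Rightarrow> 'a oracle_fun \<Rightarrow> 'a tester \<Rightarrow> verdict \<Rightarrow> real" where
  "verdict_prob oP oQ t v = measure_pmf.prob (run oP oQ t) {(v', q). v' = v}"

definition query_rate :: "'a set \<Rightarrow> nat \<Rightarrow> real \<Rightarrow> real \<Rightarrow> real" where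
  "query_rate \<Sigma> n \<epsilon>\<^sub>1 \<epsilon>\<^sub>2 = real n ^ 3 * real (card \<Sigma>) / (\<epsilon>\<^sub>2 - \<epsilon>\<^sub>1) ^ 5"

text \<open>
  A member of the class \<open>O~(f)\<close> is bounded by \<open>C * soft f c\<close> for constants \<open>C\<close> and \<open>c\<close>; the
  summand \<open>2\<close> keeps the logarithm at least \<open>1\<close>.
\<close>

definition soft :: "real \<Rightarrow> nat \<Rightarrow> real" where
  "soft f c = f * log 2 (2 + f) ^ c"

end

theory Submission
  imports Defs
begin

text \<open>
  The distance is the mean of \<open>1 - min 1 (Q(w) / P(w))\<close> for \<open>w\<close> drawn from \<open>P\<close>. By the chain rule
  \<open>Q(w)\<close> is the product of the conditional probabilities \<open>q_i(w)\<close> of the letter \<open>w_i\<close> given the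
  preceding ones, and replacing each factor by its frequency among \<open>m\<close> answers to a prefix query
  gives an unbiased estimate \<open>Q'(w)\<close>. Its relative second moment is at most
  \<open>(\<Prod>i. q_i(w) + 1/m) / Q(w)\<close>, and since the \<open>q_i\<close> sum to one over the next letter, summing
  \<open>\<Prod>i. q_i(w) + 1/m\<close> over all words telescopes to \<open>(1 + |\<Sigma>|/m)^n\<close>. Hence the sum over \<open>w\<close> of
  \<open>E |Q'(w) - Q(w)|\<close> is at most \<open>\<eta>\<close> with \<open>\<eta>^2 = (1 + |\<Sigma>|/m)^n - 1\<close>, and likewise for \<open>P\<close>.
  Plugging the estimates into \<open>1 - min 1 (Q(w) / P(w))\<close> changes the mean by at most \<open>2\<eta>\<close>. With \<open>m\<close>
  of order \<open>n |\<Sigma>| / \<delta>^2\<close>, where \<open>\<delta> = \<epsilon>\<^sub>2 - \<epsilon>\<^sub>1\<close>, and of order \<open>1 / \<delta>^2\<close> repetitions,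
  Chebyshev's inequality yields the theorem with only \<open>O(n^2 |\<Sigma>| / \<delta>^4)\<close> queries.
\<close>

section \<open>Moments of sums and products of independent samples\<close>

lemma expectation_bind_pmf_finite:
  fixes h :: "'b \<Rightarrow> real"
  assumes "finite (set_pmf D)" "\<And>x. x \<in> set_pmf D \<Longrightarrow> finite (set_pmf (K x))"
  shows "measure_pmf.expectation (bind_pmf D K) h =
    measure_pmf.expectation D (\<lambda>x. measure_pmf.expectation (K x) h)"
  using assms
  by (subst pmf_expectation_bind[where A = "set_pmf D"])
     (auto simp: integral_measure_pmf[where A = "set_pmf D"])

lemma expectation_mono_finite:
  fixes f g :: "'b \<Rightarrow> real"
  assumes "finite (set_pmf D)" "\<And>x. x \<in> set_pmf D \<Longrightarrow> f x \<le> g x"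
  shows "measure_pmf.expectation D f \<le> measure_pmf.expectation D g"
  using assms
  by (intro integral_mono_AE) (auto intro: integrable_measure_pmf_finite simp: AE_measure_pmf_iff)

primrec fold_pmf :: "('b \<Rightarrow> 'c \<Rightarrow> 'c) \<Rightarrow> 'c \<Rightarrow> 'b pmf list \<Rightarrow> 'c pmf" where
  "fold_pmf f z [] = return_pmf z"
| "fold_pmf f z (D # Ds) = bind_pmf D (\<lambda>x. map_pmf (f x) (fold_pmf f z Ds))"

lemma finite_set_fold_pmf:
  "(\<And>D. D \<in> set Ds \<Longrightarrow> finite (set_pmf D)) \<Longrightarrow> finite (set_pmf (fold_pmf f z Ds))"
  by (induction Ds) auto

lemma set_fold_pmf_induct:
  assumes "y \<in> set_pmf (fold_pmf f z Ds)" and "I z"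
    and "\<And>D x y. D \<in> set Ds \<Longrightarrow> x \<in> set_pmf D \<Longrightarrow> I y \<Longrightarrow> I (f x y)"
  shows "I y"
  using assms by (induction Ds arbitrary: y) auto

text \<open>Independence lets the expectation of a product factor, and powers distribute over
  products. The case \<open>k = 1\<close> serves unbiasedness, \<open>k = 2\<close> the second
  moment.\<close>

lemma expectation_fold_times_power:
  fixes Ds :: "real pmf list"
  assumes "\<And>D. D \<in> set Ds \<Longrightarrow> finite (set_pmf D)"
  shows "measure_pmf.expectation (fold_pmf (*) 1 Ds) (\<lambda>x. x ^ k) =
    (\<Prod>D\<leftarrow>Ds. measure_pmf.expectation D (\<lambda>x. x ^ k))"
  using assms
proof (induction Ds)
  case (Cons D Ds)
  have "measure_pmf.expectation (fold_pmf (*) 1 (D # Ds)) (\<lambda>x. x ^ k) =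
      measure_pmf.expectation D
        (\<lambda>x. measure_pmf.expectation (map_pmf ((*) x) (fold_pmf (*) 1 Ds)) (\<lambda>x. x ^ k))"
    using Cons.prems by (simp add: expectation_bind_pmf_finite finite_set_fold_pmf)
  then show ?case
    using Cons by (simp add: power_mult_distrib)
qed simp

text \<open>Variances of independent samples add: splitting off one sample, the cross term of the
  square has mean zero.\<close>

lemma expectation_fold_plus_replicate:
  fixes D :: "real pmf"
  assumes fin: "finite (set_pmf D)"
  defines "\<mu> \<equiv> measure_pmf.expectation D (\<lambda>x. x)"
  defines "S \<equiv> \<lambda>m. fold_pmf (+) 0 (replicate m D)"
  shows "measure_pmf.expectation (S m) (\<lambda>x. x) = real m * \<mu>"
    and "measure_pmf.expectation (S m) (\<lambda>x. (x - real m * \<mu>)\<^sup>2) =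
      real m * measure_pmf.expectation D (\<lambda>x. (x - \<mu>)\<^sup>2)"
proof -
  have finS: "finite (set_pmf (S m))" for m
    unfolding S_def using fin by (intro finite_set_fold_pmf) auto
  note int = integrable_measure_pmf_finite[OF fin] integrable_measure_pmf_finite[OF finS]
  have step: "measure_pmf.expectation (S (Suc m)) h =
      measure_pmf.expectation D (\<lambda>x. measure_pmf.expectation (S m) (\<lambda>y. h (x + y)))"
    for m and h :: "real \<Rightarrow> real"
    using finS[of m] fin by (simp add: S_def expectation_bind_pmf_finite)
  have mean: "measure_pmf.expectation (S m) (\<lambda>x. x) = real m * \<mu>" for m
  proof (induction m)
    case 0
    show ?case by (simp add: S_def)
  next
    case (Suc m)
    have "measure_pmf.expectation (S m) (\<lambda>y. x + y) = x + real m * \<mu>" for x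
      using Bochner_Integration.integral_add[OF int(2)[of m "\<lambda>_. x"] int(2)[of m "\<lambda>y. y"]] Suc by simp
    then show ?case
      unfolding step by (simp add: int \<mu>_def algebra_simps)
  qed
  show "measure_pmf.expectation (S m) (\<lambda>x. x) = real m * \<mu>"
    by (rule mean)
  show "measure_pmf.expectation (S m) (\<lambda>x. (x - real m * \<mu>)\<^sup>2) =
      real m * measure_pmf.expectation D (\<lambda>x. (x - \<mu>)\<^sup>2)"
  proof (induction m)
    case 0
    show ?case by (simp add: S_def)
  next
    case (Suc m)
    have *: "measure_pmf.expectation (S m) (\<lambda>y. (x + y - real (Suc m) * \<mu>)\<^sup>2) =
        (x - \<mu>)\<^sup>2 + measure_pmf.expectation (S m) (\<lambda>y. (y - real m * \<mu>)\<^sup>2)" for x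
    proof -
      have "(x + y - real (Suc m) * \<mu>)\<^sup>2 =
          (x - \<mu>)\<^sup>2 + 2 * (x - \<mu>) * (y - real m * \<mu>) + (y - real m * \<mu>)\<^sup>2" for y
        by (simp add: power2_eq_square algebra_simps)
      moreover have "measure_pmf.expectation (S m) (\<lambda>y. y - real m * \<mu>) = 0"
        by (simp add: int mean)
      ultimately show ?thesis
        by (simp add: int)
    qed
    show ?case
      unfolding step * using Suc by (simp add: int algebra_simps)
  qed
qed

text \<open>Applied twice: to the letter frequencies and to the final average over all
  trials.\<close>

lemma expectation_average:
  fixes D :: "real pmf"
  assumes fin: "finite (set_pmf D)" and "m > 0"
  defines "\<mu> \<equiv> measure_pmf.expectation D (\<lambda>x. x)"
  defines "A \<equiv> map_pmf (\<lambda>x. x / real m) (fold_pmf (+) 0 (replicate m D))"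
  shows "measure_pmf.expectation A (\<lambda>x. x) = \<mu>"
    and "measure_pmf.variance A (\<lambda>x. x) = measure_pmf.variance D (\<lambda>x. x) / real m"
    and "finite (set_pmf A)"
proof -
  show *: "measure_pmf.expectation A (\<lambda>x. x) = \<mu>"
    using expectation_fold_plus_replicate(1)[OF fin] \<open>m > 0\<close> by (simp add: A_def \<mu>_def)
  have "(x / real m - \<mu>)\<^sup>2 = (x - real m * \<mu>)\<^sup>2 / (real m)\<^sup>2" for x
    using \<open>m > 0\<close> by (simp add: power_divide[symmetric] diff_divide_distrib)
  then show "measure_pmf.variance A (\<lambda>x. x) = measure_pmf.variance D (\<lambda>x. x) / real m"
    unfolding * using expectation_fold_plus_replicate(2)[OF fin] \<open>m > 0\<close>
    by (simp add: A_def \<mu>_def power2_eq_square)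
  show "finite (set_pmf A)"
    unfolding A_def using fin by (auto intro!: finite_set_fold_pmf)
qed

section \<open>Sampling subroutines as testers with exact query counts\<close>

text \<open>
  Subroutines returning a value are written in continuation-passing style: \<open>c\<close> samples from \<open>D\<close>
  with exactly \<open>N\<close> queries, whatever tester is run on the result.
\<close>

definition implements ::
    "'a oracle_fun \<Rightarrow> 'a oracle_fun \<Rightarrow> nat \<Rightarrow> (('r \<Rightarrow> 'a tester) \<Rightarrow> 'a tester) \<Rightarrow> 'r pmf \<Rightarrow> bool" where
  "implements oP oQ N c D \<longleftrightarrow>
     (\<forall>k. run oP oQ (c k) = bind_pmf D (\<lambda>r. map_pmf (map_prod id ((+) N)) (run oP oQ (k r))))"

lemma implements_return: "implements oP oQ 0 (\<lambda>k. k r) (return_pmf r)"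
proof -
  have "map_prod id ((+) 0) = (id :: verdict \<times> nat \<Rightarrow> _)"
    by (auto simp: fun_eq_iff)
  then show ?thesis
    by (simp add: implements_def bind_return_pmf)
qed

lemma implements_Query_P: "implements oP oQ 1 (Query_P \<rho>) (oP \<rho>)"
  unfolding implements_def plus_1_eq_Suc by simp

lemma implements_Query_Q: "implements oP oQ 1 (Query_Q \<rho>) (oQ \<rho>)"
  unfolding implements_def plus_1_eq_Suc by simp

text \<open>\<open>N\<close> is the same for every intermediate result \<open>r\<close>, so the
  composite again makes a fixed number of queries.\<close>

lemma implements_bind:
  assumes c: "implements oP oQ M c D"
    and d: "\<And>r. r \<in> set_pmf D \<Longrightarrow> implements oP oQ N (d r) (K r)"
  shows "implements oP oQ (M + N) (\<lambda>k. c (\<lambda>r. d r k)) (bind_pmf D K)"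
  unfolding implements_def
proof
  fix k
  have [simp]: "map_prod id ((+) M) \<circ> map_prod id ((+) N) =
      (map_prod id ((+) (M + N)) :: verdict \<times> nat \<Rightarrow> _)"
    by (auto simp: fun_eq_iff)
  have "run oP oQ (c (\<lambda>r. d r k)) =
      bind_pmf D (\<lambda>r. map_pmf (map_prod id ((+) M)) (run oP oQ (d r k)))"
    using c by (simp add: implements_def)
  also have "\<dots> = bind_pmf D (\<lambda>r. bind_pmf (K r)
      (\<lambda>s. map_pmf (map_prod id ((+) (M + N))) (run oP oQ (k s))))"
    using d by (intro bind_pmf_cong refl)
      (simp add: implements_def map_bind_pmf pmf.map_comp)
  finally show "run oP oQ (c (\<lambda>r. d r k)) =
      bind_pmf (bind_pmf D K) (\<lambda>r. map_pmf (map_prod id ((+) (M + N))) (run oP oQ (k r)))"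
    by (simp add: bind_assoc_pmf)
qed

lemma implements_map:
  assumes "implements oP oQ N c D"
  shows "implements oP oQ N (\<lambda>k. c (\<lambda>r. k (f r))) (map_pmf f D)"
  using implements_bind[OF assms implements_return] by (simp add: map_pmf_def)

text \<open>The continuation-passing counterpart of \<open>fold_pmf\<close>.\<close>

primrec fold_tester ::
    "('b \<Rightarrow> 'c \<Rightarrow> 'c) \<Rightarrow> 'c \<Rightarrow> (('b \<Rightarrow> 'a tester) \<Rightarrow> 'a tester) list \<Rightarrow> ('c \<Rightarrow> 'a tester) \<Rightarrow> 'a tester" where
  "fold_tester f z [] = (\<lambda>k. k z)"
| "fold_tester f z (c # cs) = (\<lambda>k. c (\<lambda>x. fold_tester f z cs (\<lambda>y. k (f x y))))"

lemma implements_fold: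
  assumes "list_all2 (implements oP oQ N) cs Ds"
  shows "implements oP oQ (length cs * N) (fold_tester f z cs) (fold_pmf f z Ds)"
  using assms
proof (induction rule: list_all2_induct)
  case Nil
  show ?case using implements_return by simp
next
  case (Cons c cs D Ds)
  then show ?case
    using implements_bind[OF Cons(1) implements_map[OF Cons(3)]] by simp
qed

section \<open>Words, prefix queries and their subcubes\<close>

lemma finite_words: "finite \<Sigma> \<Longrightarrow> finite (words \<Sigma> n)"
  unfolding words_def by (rule finite_lists_length_eq)

lemma sum_words_Suc:
  "(\<Sum>w\<in>words \<Sigma> (Suc n). f w) = (\<Sum>u\<in>words \<Sigma> n. \<Sum>a\<in>\<Sigma>. f (u @ [a]))"
proof -
  have "words \<Sigma> (Suc n) = (\<lambda>(u, a). u @ [a]) ` (words \<Sigma> n \<times> \<Sigma>)"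
  proof (intro set_eqI iffI)
    fix w assume "w \<in> words \<Sigma> (Suc n)"
    then have w: "w \<noteq> []" "set w \<subseteq> \<Sigma>" "length w = Suc n"
      by (auto simp: words_def)
    then have "w = butlast w @ [last w]" "butlast w \<in> words \<Sigma> n" "last w \<in> \<Sigma>"
      by (auto simp: words_def dest: in_set_butlastD)
    then show "w \<in> (\<lambda>(u, a). u @ [a]) ` (words \<Sigma> n \<times> \<Sigma>)"
      by (auto simp: image_iff intro!: bexI[of _ "(butlast w, last w)"])
  qed (auto simp: words_def)
  then have "(\<Sum>w\<in>words \<Sigma> (Suc n). f w) = (\<Sum>(u, a)\<in>words \<Sigma> n \<times> \<Sigma>. f (u @ [a]))"
    by (auto simp: sum.reindex inj_on_def case_prod_unfold intro!: sum.cong)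
  then show ?thesis
    by (simp add: sum.cartesian_product)
qed

text \<open>If the subcube has positive mass, the answer's letter at position
  \<open>length u\<close> follows the conditional law that the chain rule needs.\<close>

definition prefix_query :: "nat \<Rightarrow> 'a list \<Rightarrow> 'a query" where
  "prefix_query n u = map Some u @ replicate (n - length u) None"

lemma prefix_query_in_queries:
  "u \<in> words \<Sigma> j \<Longrightarrow> j \<le> n \<Longrightarrow> prefix_query n u \<in> queries \<Sigma> n"
  by (auto simp: prefix_query_def queries_def words_def)

lemma subcube_prefix_query:
  assumes "length u \<le> n"
  shows "subcube \<Sigma> n (prefix_query n u) = {v \<in> words \<Sigma> n. take (length u) v = u}"
proof -
  have "(\<forall>i<n. prefix_query n u ! i \<noteq> None \<longrightarrow> prefix_query n u ! i = Some (v ! i)) \<longleftrightarrow>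
      take (length u) v = u" if "length v = n" for v
    using assms that by (auto simp: prefix_query_def nth_append list_eq_iff_nth_eq)
  then show ?thesis
    by (auto simp: subcube_def words_def)
qed

lemma prob_cond_pmf:
  assumes "finite s" "measure_pmf.prob D s > 0"
  shows "measure_pmf.prob (cond_pmf D s) A = measure_pmf.prob D (A \<inter> s) / measure_pmf.prob D s"
proof -
  have ne: "set_pmf D \<inter> s \<noteq> {}"
    using assms(2) measure_pmf_zero_iff[of D s] by auto
  have "measure_pmf.prob (cond_pmf D s) A = measure_pmf.prob (cond_pmf D s) (A \<inter> s)"
    using ne by (intro measure_pmf.finite_measure_eq_AE) (auto simp: AE_measure_pmf_iff)
  also have "\<dots> = (\<Sum>x\<in>A \<inter> s. pmf D x / measure_pmf.prob D s)"
    using ne assms(1) by (subst measure_measure_pmf_finite) (auto simp: pmf_cond)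
  finally show ?thesis
    using assms(1) by (simp add: sum_divide_distrib[symmetric] measure_measure_pmf_finite)
qed

section \<open>Letter frequencies and word estimates\<close>

definition frequency :: "nat \<Rightarrow> 'a list pmf \<Rightarrow> nat \<Rightarrow> 'a \<Rightarrow> real pmf" where
  "frequency m D i a =
     map_pmf (\<lambda>x. x / real m)
       (fold_pmf (+) 0 (replicate m (map_pmf (\<lambda>v. of_bool (v ! i = a)) D)))"

text \<open>A 0/1 variable of mean \<open>q\<close> has variance \<open>q - q\<^sup>2\<close>, which
  averaging divides by \<open>m\<close>. The bound keeps a factor \<open>q\<close>, so that these
  factors can later be multiplied to the probability of a word.\<close>

lemma frequency_moments:
  fixes i :: nat and a :: 'a
  assumes "finite (set_pmf D)" and "m > 0"
  defines "q \<equiv> measure_pmf.prob D {v. v ! i = a}"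
  shows "finite (set_pmf (frequency m D i a))"
    and "measure_pmf.expectation (frequency m D i a) (\<lambda>x. x) = q"
    and "measure_pmf.expectation (frequency m D i a) (\<lambda>x. x\<^sup>2) \<le> q * (q + 1 / real m)"
proof -
  define B where "B = map_pmf (\<lambda>v. of_bool (v ! i = a) :: real) D"
  have finB: "finite (set_pmf B)"
    using assms(1) by (simp add: B_def)
  have q: "measure_pmf.expectation B (\<lambda>x. x) = q" "measure_pmf.expectation B (\<lambda>x. x\<^sup>2) = q"
  proof -
    have "(\<lambda>v. of_bool (v ! i = a)) = (indicator {v. v ! i = a} :: 'a list \<Rightarrow> real)"
      by (auto simp: fun_eq_iff)
    moreover have "(indicator A v)\<^sup>2 = (indicator A v :: real)" for A and v :: "'a list"
      by (simp add: indicator_def)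
    ultimately show "measure_pmf.expectation B (\<lambda>x. x) = q" "measure_pmf.expectation B (\<lambda>x. x\<^sup>2) = q"
      by (simp_all add: B_def q_def)
  qed
  note avg = expectation_average[OF finB \<open>m > 0\<close>, folded frequency_def[of m D i a, folded B_def]]
  show fin: "finite (set_pmf (frequency m D i a))"
    and mean: "measure_pmf.expectation (frequency m D i a) (\<lambda>x. x) = q"
    using avg q by auto
  note int = integrable_measure_pmf_finite[OF fin] integrable_measure_pmf_finite[OF finB]
  have "measure_pmf.expectation (frequency m D i a) (\<lambda>x. x\<^sup>2) = q\<^sup>2 + (q - q\<^sup>2) / real m"
    using avg(2) mean q measure_pmf.variance_eq[OF int(1)[of "\<lambda>x. x"] int(1)[of "\<lambda>x. x\<^sup>2"]]
      measure_pmf.variance_eq[OF int(2)[of "\<lambda>x. x"] int(2)[of "\<lambda>x. x\<^sup>2"]] by simp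
  also have "\<dots> \<le> q\<^sup>2 + q / real m"
    by (intro add_left_mono divide_right_mono) auto
  finally show "measure_pmf.expectation (frequency m D i a) (\<lambda>x. x\<^sup>2) \<le> q * (q + 1 / real m)"
    by (simp add: power2_eq_square algebra_simps)
qed

lemma frequency_nonneg: "x \<in> set_pmf (frequency m D i a) \<Longrightarrow> x \<ge> 0"
  by (auto simp: frequency_def elim!: set_fold_pmf_induct[where I = "\<lambda>x. 0 \<le> x / _"] split: if_splits
      simp: add_divide_distrib)

text \<open>Each position uses fresh samples, so the factors are independent and their moments
  multiply.\<close>

definition word_estimate :: "nat \<Rightarrow> 'a oracle_fun \<Rightarrow> nat \<Rightarrow> 'a list \<Rightarrow> real pmf" where
  "word_estimate m orc n w =
     fold_pmf (*) 1 (map (\<lambda>i. frequency m (orc (prefix_query n (take i w))) i (w ! i)) [0..<n])"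

section \<open>Chain rule and total estimation error for one oracle\<close>

locale subcond =
  fixes \<Sigma> :: "'a set" and n :: nat and D :: "'a list pmf" and orc :: "'a oracle_fun"
  assumes finite_alphabet: "finite \<Sigma>"
    and support: "set_pmf D \<subseteq> words \<Sigma> n"
    and orc: "subcond_oracle \<Sigma> n D orc"
begin

text \<open>Taken from the oracle's answer rather than from \<open>D\<close>, so that it makes sense
  after prefixes of mass zero too.\<close>

definition next_prob :: "'a list \<Rightarrow> 'a \<Rightarrow> real" where
  "next_prob u a = measure_pmf.prob (orc (prefix_query n u)) {v. v ! length u = a}"

lemma next_prob_nonneg: "next_prob u a \<ge> 0"
  by (simp add: next_prob_def)

lemma set_oracle_prefix_query:
  "u \<in> words \<Sigma> j \<Longrightarrow> j \<le> n \<Longrightarrow> set_pmf (orc (prefix_query n u)) \<subseteq> words \<Sigma> n"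
  using orc prefix_query_in_queries[of u \<Sigma> j n] by (auto simp: subcond_oracle_def)

text \<open>
  On null subcubes the sum is still one because the oracle answers with words over \<open>\<Sigma>\<close>; this lets
  the telescoping sum below range over all words.
\<close>

lemma sum_next_prob:
  assumes "u \<in> words \<Sigma> j" "j < n"
  shows "(\<Sum>a\<in>\<Sigma>. next_prob u a) = 1"
proof -
  let ?M = "orc (prefix_query n u)"
  have "length u = j"
    using assms by (simp add: words_def)
  then have "(\<Sum>a\<in>\<Sigma>. next_prob u a) = measure_pmf.prob ?M (\<Union>a\<in>\<Sigma>. {v. v ! j = a})"
    using finite_alphabet unfolding next_prob_def
    by (subst measure_pmf.finite_measure_finite_Union) (auto simp: disjoint_family_on_def)
  also have "v ! j \<in> \<Sigma>" if "v \<in> set_pmf ?M" for v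
  proof -
    have "v \<in> words \<Sigma> n"
      using set_oracle_prefix_query[of u j] assms that by auto
    then show ?thesis
      using nth_mem[of j v] assms(2) unfolding words_def by blast
  qed
  then have "measure_pmf.prob ?M (\<Union>a\<in>\<Sigma>. {v. v ! j = a}) = measure_pmf.prob ?M UNIV"
    by (intro measure_pmf.finite_measure_eq_AE) (auto simp: AE_measure_pmf_iff)
  finally show ?thesis by simp
qed

text \<open>Chain rule: on a prefix of positive mass the oracle conditions \<open>D\<close> on that
  prefix, so each factor is the quotient of two consecutive prefix masses.\<close>

lemma prod_next_prob_prefix:
  assumes w: "w \<in> words \<Sigma> n" and "j \<le> n"
  shows "(\<Prod>i<j. next_prob (take i w) (w ! i)) =
    measure_pmf.prob D {v \<in> words \<Sigma> n. take j v = take j w}"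
  using \<open>j \<le> n\<close>
proof (induction j)
  case 0
  have "measure_pmf.prob D (words \<Sigma> n) = measure_pmf.prob D UNIV"
    using support by (intro measure_pmf.finite_measure_eq_AE) (auto simp: AE_measure_pmf_iff)
  then show ?case by simp
next
  case (Suc j)
  define B where "B = (\<lambda>j. {v \<in> words \<Sigma> n. take j v = take j w})"
  have len: "length w = n" "take j w \<in> words \<Sigma> j" "length (take j w) = j"
    using w Suc.prems by (auto simp: words_def dest: in_set_takeD)
  have B_Suc: "{v. v ! j = w ! j} \<inter> B j = B (Suc j)"
    using Suc.prems len by (auto simp: B_def words_def take_Suc_conv_app_nth)
  have finB: "finite (B j)"
    using finite_words[OF finite_alphabet] by (simp add: B_def)
  have IH: "(\<Prod>i<j. next_prob (take i w) (w ! i)) = measure_pmf.prob D (B j)"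
    using Suc by (simp add: B_def)
  show ?case
  proof (cases "measure_pmf.prob D (B j) = 0")
    case True
    \<comment> \<open>After a null prefix the next factor is arbitrary, but the earlier factors
      already multiply to zero and the longer prefix is null as well.\<close>
    have "measure_pmf.prob D (B (Suc j)) \<le> measure_pmf.prob D (B j)"
      using B_Suc by (intro measure_pmf.finite_measure_mono) auto
    then have "measure_pmf.prob D (B (Suc j)) = 0"
      using True by (simp add: measure_le_0_iff)
    then show ?thesis
      using IH True by (simp add: B_def)
  next
    case False
    then have pos: "measure_pmf.prob D (B j) > 0"
      by (simp add: zero_less_measure_iff)
    have "subcube \<Sigma> n (prefix_query n (take j w)) = B j"
      using subcube_prefix_query[of "take j w" n \<Sigma>] Suc.prems len by (simp add: B_def)
    then have "orc (prefix_query n (take j w)) = cond_pmf D (B j)"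
      using orc pos prefix_query_in_queries[OF len(2), of n] Suc.prems
      by (auto simp: subcond_oracle_def)
    then have "next_prob (take j w) (w ! j) = measure_pmf.prob D (B (Suc j)) / measure_pmf.prob D (B j)"
      unfolding next_prob_def len(3) using prob_cond_pmf[OF finB pos] B_Suc by simp
    then show ?thesis
      using IH pos by (simp add: B_def)
  qed
qed

lemma prod_next_prob:
  assumes w: "w \<in> words \<Sigma> n"
  shows "(\<Prod>i<n. next_prob (take i w) (w ! i)) = pmf D w"
proof -
  have "{v \<in> words \<Sigma> n. take n v = take n w} = {w}"
    using w by (auto simp: words_def)
  then show ?thesis
    using prod_next_prob_prefix[OF w order_refl] by (simp add: measure_pmf_single)
qed

text \<open>Split off the last letter: the earlier factors do not depend on it, and its own factor
  sums to \<open>1 + real (card \<Sigma>) * c\<close> whatever the prefix.\<close>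

lemma sum_prod_next_prob:
  "j \<le> n \<Longrightarrow> (\<Sum>w\<in>words \<Sigma> j. \<Prod>i<j. next_prob (take i w) (w ! i) + c) =
    (1 + real (card \<Sigma>) * c) ^ j"
proof (induction j)
  case 0
  have "words \<Sigma> 0 = {[]}"
    by (auto simp: words_def)
  then show ?case by simp
next
  case (Suc j)
  have *: "(\<Sum>a\<in>\<Sigma>. \<Prod>i<Suc j. next_prob (take i (u @ [a])) ((u @ [a]) ! i) + c) =
      (\<Prod>i<j. next_prob (take i u) (u ! i) + c) * (1 + real (card \<Sigma>) * c)"
    if u: "u \<in> words \<Sigma> j" for u
  proof -
    have len: "length u = j"
      using u by (simp add: words_def)
    have "(\<Prod>i<Suc j. next_prob (take i (u @ [a])) ((u @ [a]) ! i) + c) =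
        (\<Prod>i<j. next_prob (take i u) (u ! i) + c) * (next_prob u a + c)" for a
      using len by (simp add: nth_append)
    then show ?thesis
      using sum_next_prob[OF u] Suc.prems by (simp add: sum_distrib_left[symmetric] sum.distrib)
  qed
  have "(\<Sum>w\<in>words \<Sigma> (Suc j). \<Prod>i<Suc j. next_prob (take i w) (w ! i) + c) =
      (\<Sum>u\<in>words \<Sigma> j. (\<Prod>i<j. next_prob (take i u) (u ! i) + c) * (1 + real (card \<Sigma>) * c))"
    unfolding sum_words_Suc by (intro sum.cong refl *)
  then show ?case
    using Suc by (simp add: sum_distrib_right[symmetric])
qed

lemma finite_set_oracle_prefix_query:
  assumes "w \<in> words \<Sigma> n" "i < n"
  shows "finite (set_pmf (orc (prefix_query n (take i w))))"
proof -
  have "take i w \<in> words \<Sigma> i"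
    using assms by (auto simp: words_def dest: in_set_takeD)
  then show ?thesis
    using set_oracle_prefix_query assms finite_words[OF finite_alphabet]
    by (meson finite_subset less_imp_le)
qed

text \<open>Moments multiply over the positions. In each second moment bound
  \<open>q * (q + 1 / m)\<close> the first factor goes into \<open>pmf D w\<close> by the chain
  rule; the second is kept for the telescoping sum.\<close>

lemma word_estimate_moments:
  assumes w: "w \<in> words \<Sigma> n" and "m > 0"
  shows "finite (set_pmf (word_estimate m orc n w))"
    and "measure_pmf.expectation (word_estimate m orc n w) (\<lambda>x. x) = pmf D w"
    and "measure_pmf.expectation (word_estimate m orc n w) (\<lambda>x. x\<^sup>2) \<le>
      pmf D w * (\<Prod>i<n. next_prob (take i w) (w ! i) + 1 / real m)"
proof -
  define F where "F = (\<lambda>i. frequency m (orc (prefix_query n (take i w))) i (w ! i))"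
  have len: "i < n \<Longrightarrow> length (take i w) = i" for i
    using w by (simp add: words_def)
  have F: "finite (set_pmf (F i))"
    "measure_pmf.expectation (F i) (\<lambda>x. x) = next_prob (take i w) (w ! i)"
    "measure_pmf.expectation (F i) (\<lambda>x. x\<^sup>2) \<le>
      next_prob (take i w) (w ! i) * (next_prob (take i w) (w ! i) + 1 / real m)" if "i < n" for i
    using frequency_moments[OF finite_set_oracle_prefix_query[OF w that] \<open>m > 0\<close>] len[OF that]
    by (auto simp: F_def next_prob_def)
  have moment: "measure_pmf.expectation (word_estimate m orc n w) (\<lambda>x. x ^ k) =
      (\<Prod>i<n. measure_pmf.expectation (F i) (\<lambda>x. x ^ k))" for k
    unfolding word_estimate_def F_def[symmetric] using F(1)
    by (subst expectation_fold_times_power)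
       (auto simp: prod.list_conv_set_nth atLeast0LessThan o_def)
  show "finite (set_pmf (word_estimate m orc n w))"
    unfolding word_estimate_def F_def[symmetric] using F(1) by (auto intro!: finite_set_fold_pmf)
  show "measure_pmf.expectation (word_estimate m orc n w) (\<lambda>x. x) = pmf D w"
    using moment[of 1] F(2) prod_next_prob[OF w] by simp
  have "(\<Prod>i<n. measure_pmf.expectation (F i) (\<lambda>x. x\<^sup>2)) \<le>
      (\<Prod>i<n. next_prob (take i w) (w ! i) * (next_prob (take i w) (w ! i) + 1 / real m))"
    using F(3) by (intro prod_mono) (auto intro!: integral_nonneg)
  then show "measure_pmf.expectation (word_estimate m orc n w) (\<lambda>x. x\<^sup>2) \<le>
      pmf D w * (\<Prod>i<n. next_prob (take i w) (w ! i) + 1 / real m)"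
    using moment[of 2] prod_next_prob[OF w] by (simp add: prod.distrib)
qed

lemma word_estimate_nonneg: "x \<in> set_pmf (word_estimate m orc n w) \<Longrightarrow> x \<ge> 0"
  unfolding word_estimate_def
  by (erule set_fold_pmf_induct) (auto dest: frequency_nonneg)

text \<open>A weighted AM-GM inequality keeps the bound linear in \<open>pmf D w\<close> and in the
  product, whose sums over all words are both known.\<close>

lemma word_estimate_error:
  assumes w: "w \<in> words \<Sigma> n" and "m > 0" and "\<eta> > 0"
  shows "measure_pmf.expectation (word_estimate m orc n w) (\<lambda>x. \<bar>x - pmf D w\<bar>) \<le>
    (\<eta> * pmf D w + ((\<Prod>i<n. next_prob (take i w) (w ! i) + 1 / real m) - pmf D w) / \<eta>) / 2"
proof -
  define E where "E = word_estimate m orc n w"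
  define d where "d = pmf D w"
  define R where "R = (\<Prod>i<n. next_prob (take i w) (w ! i) + 1 / real m)"
  note moments = word_estimate_moments[OF w \<open>m > 0\<close>, folded E_def d_def R_def]
  note int = integrable_measure_pmf_finite[OF moments(1)]
  have "R \<ge> 0"
    unfolding R_def by (intro prod_nonneg) (auto intro: add_nonneg_nonneg next_prob_nonneg)
  have "measure_pmf.expectation E (\<lambda>x. \<bar>x - d\<bar>) \<le> (\<eta> * d + (R - d) / \<eta>) / 2"
  proof (cases "d = 0")
    case True
    \<comment> \<open>A nonnegative estimate of mean zero has mean error zero. The case is separate
      because the other one divides by \<open>d\<close>.\<close>
    have "measure_pmf.expectation E (\<lambda>x. \<bar>x - d\<bar>) = measure_pmf.expectation E (\<lambda>x. x)"
      using True word_estimate_nonneg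
      by (intro integral_cong_AE) (auto simp: AE_measure_pmf_iff E_def)
    then show ?thesis
      using True moments \<open>R \<ge> 0\<close> \<open>\<eta> > 0\<close> by simp
  next
    case False
    then have "d > 0"
      by (simp add: d_def pmf_positive_iff set_pmf_iff)
    have "\<bar>x - d\<bar> \<le> \<eta> * d / 2 + (x\<^sup>2 - 2 * d * x + d\<^sup>2) / (2 * \<eta> * d)" for x
    proof -
      \<comment> \<open>AM-GM with the error measured against \<open>\<eta> * d\<close>, that is,
        relative to the true value.\<close>
      have "0 \<le> (\<bar>x - d\<bar> - \<eta> * d)\<^sup>2 / (2 * \<eta> * d)"
        using \<open>d > 0\<close> \<open>\<eta> > 0\<close> by simp
      also have "\<dots> = \<eta> * d / 2 + (x\<^sup>2 - 2 * d * x + d\<^sup>2) / (2 * \<eta> * d) - \<bar>x - d\<bar>"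
        using \<open>d > 0\<close> \<open>\<eta> > 0\<close>
          by (simp add: field_simps power2_diff) (simp add: power2_eq_square algebra_simps)
      finally show ?thesis by simp
    qed
    then have "measure_pmf.expectation E (\<lambda>x. \<bar>x - d\<bar>) \<le>
        measure_pmf.expectation E (\<lambda>x. \<eta> * d / 2 + (x\<^sup>2 - 2 * d * x + d\<^sup>2) / (2 * \<eta> * d))"
      by (intro expectation_mono_finite moments)
    also have "\<dots> = \<eta> * d / 2 + (measure_pmf.expectation E (\<lambda>x. x\<^sup>2) - d\<^sup>2) / (2 * \<eta> * d)"
      using moments(2) by (simp add: int power2_eq_square)
    also have "\<dots> \<le> \<eta> * d / 2 + (d * R - d\<^sup>2) / (2 * \<eta> * d)"
      using moments(3) \<open>d > 0\<close> \<open>\<eta> > 0\<close> by (intro add_left_mono divide_right_mono) auto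
    also have "\<dots> = (\<eta> * d + (R - d) / \<eta>) / 2"
      using \<open>d > 0\<close> \<open>\<eta> > 0\<close> by (simp add: field_simps power2_eq_square)
    finally show ?thesis .
  qed
  then show ?thesis
    by (simp add: E_def d_def R_def)
qed

text \<open>The query without constraints conditions on a set of mass one; a trial uses it to draw
  its word.\<close>

lemma oracle_prefix_query_Nil: "orc (prefix_query n []) = D"
proof -
  have one: "measure_pmf.prob D (words \<Sigma> n) = 1"
    using support by (intro measure_pmf.prob_eq_1[THEN iffD2]) (auto simp: AE_measure_pmf_iff)
  have "set_pmf D \<inter> words \<Sigma> n \<noteq> {}"
    using support set_pmf_not_empty[of D] by auto
  then have "cond_pmf D (words \<Sigma> n) = D"
    using support one by (intro pmf_eqI) (auto simp: pmf_cond pmf_eq_0_set_pmf)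
  moreover have "subcube \<Sigma> n (prefix_query n []) = words \<Sigma> n"
    using subcube_prefix_query[of "[]" n \<Sigma>] by simp
  moreover have "prefix_query n [] \<in> queries \<Sigma> n"
    by (rule prefix_query_in_queries[of _ _ 0]) (auto simp: words_def)
  ultimately show ?thesis
    using orc one by (auto simp: subcond_oracle_def)
qed

lemma sum_pmf_words: "(\<Sum>w\<in>words \<Sigma> n. pmf D w) = 1"
  using support finite_words[OF finite_alphabet] by (simp add: sum_pmf_eq_1)

text \<open>Summing the pointwise bounds, \<open>pmf D w\<close> contributes one and the products
  \<open>(1 + real (card \<Sigma>) / real m) ^ n\<close>. The choice of \<open>\<eta>\<close> makes
  both halves of the bound at most \<open>\<eta> / 2\<close>.\<close>

lemma sum_word_estimate_error:
  assumes "m > 0" "\<eta> > 0" and \<eta>: "(1 + real (card \<Sigma>) / real m) ^ n \<le> 1 + \<eta>\<^sup>2"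
  shows "(\<Sum>w\<in>words \<Sigma> n. measure_pmf.expectation (word_estimate m orc n w) (\<lambda>x. \<bar>x - pmf D w\<bar>)) \<le> \<eta>"
proof -
  have "(\<Sum>w\<in>words \<Sigma> n. measure_pmf.expectation (word_estimate m orc n w) (\<lambda>x. \<bar>x - pmf D w\<bar>)) \<le>
      (\<Sum>w\<in>words \<Sigma> n. (\<eta> * pmf D w +
        ((\<Prod>i<n. next_prob (take i w) (w ! i) + 1 / real m) - pmf D w) / \<eta>) / 2)"
    using assms by (intro sum_mono word_estimate_error) auto
  also have "\<dots> = (\<eta> + ((1 + real (card \<Sigma>) / real m) ^ n - 1) / \<eta>) / 2"
    using sum_prod_next_prob[of n "1 / real m"]
    by (simp add: sum_divide_distrib[symmetric] sum.distrib sum_subtractf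
        sum_distrib_left[symmetric] sum_pmf_words)
  also have "\<dots> \<le> (\<eta> + \<eta>\<^sup>2 / \<eta>) / 2"
    using \<eta> \<open>\<eta> > 0\<close> by (intro divide_right_mono add_left_mono) auto
  finally show ?thesis
    using \<open>\<eta> > 0\<close> by (simp add: power2_eq_square)
qed

end

section \<open>From word estimates to the total variation distance\<close>

text \<open>The bound also covers the junk value \<open>y / 0 = 0\<close> of a vanishing estimate of \<open>p\<close>.\<close>

lemma min_ratio_error:
  fixes p q x y :: real
  assumes "p \<ge> 0" "q \<ge> 0" "x \<ge> 0" "y \<ge> 0"
  shows "\<bar>p * (1 - min 1 (y / x)) - (p - min p q)\<bar> \<le> \<bar>x - p\<bar> + \<bar>y - q\<bar>"
proof -
  \<comment> \<open>The intermediate value \<open>min p y\<close> separates the two errors: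
    exchanging \<open>x\<close> for \<open>p\<close> costs \<bar>x - p\<bar>, exchanging
    \<open>y\<close> for \<open>q\<close> costs \<bar>y - q\<bar>.\<close>
  have "\<bar>p * min 1 (y / x) - min p y\<bar> \<le> \<bar>x - p\<bar>"
  proof (cases "x \<le> y")
    case True
    \<comment> \<open>If \<open>x = 0\<close>, the ratio is zero and the error is
      \<open>min p y\<close>, at most \<open>p = \<bar>x - p\<bar>\<close>.\<close>
    then have "x = 0 \<or> min 1 (y / x) = 1"
      using assms by (auto simp: min_def field_simps)
    then show ?thesis
      using True assms by (auto simp: min_def)
  next
    case False
    define t where "t = y / x"
    have t: "0 \<le> t" "t < 1" "y = t * x"
      using False assms by (auto simp: t_def)
    have "\<bar>p * t - min p (t * x)\<bar> \<le> \<bar>x - p\<bar>"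
    proof (cases "p \<le> t * x")
      case True
      have "t * p \<le> p" "t * x \<le> x"
        using t assms mult_right_mono[of t 1 p] mult_right_mono[of t 1 x] by auto
      \<comment> \<open>With \<open>p \<le> t * x\<close> this gives
        \<open>p - t * p \<le> t * x - t * p \<le> x - p\<close>.\<close>
      moreover have "0 \<le> (1 - t) * (x - p)"
        using t True \<open>t * x \<le> x\<close> by (intro mult_nonneg_nonneg) auto
      ultimately show ?thesis
        using True by (simp add: algebra_simps)
    next
      case False
      have "\<bar>p * t - t * x\<bar> = t * \<bar>x - p\<bar>"
        using t abs_mult[of t "x - p"] by (simp add: algebra_simps abs_minus_commute)
      also have "\<dots> \<le> 1 * \<bar>x - p\<bar>"
        using t by (intro mult_right_mono) auto
      finally show ?thesis
        using False by simp
    qed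
    then show ?thesis
      using t False assms by (simp add: t_def[symmetric])
  qed
  moreover have "\<bar>min p y - min p q\<bar> \<le> \<bar>y - q\<bar>"
    by auto
  moreover have "\<bar>(p - a) - (p - d)\<bar> \<le> c + e" if "\<bar>a - b\<bar> \<le> c" "\<bar>b - d\<bar> \<le> e" for a b c d e :: real
    using that by linarith
  ultimately show ?thesis
    unfolding right_diff_distrib mult_1_right by blast
qed

definition trial :: "nat \<Rightarrow> nat \<Rightarrow> 'a oracle_fun \<Rightarrow> 'a oracle_fun \<Rightarrow> real pmf" where
  "trial m n oP oQ =
     bind_pmf (oP (prefix_query n [])) (\<lambda>w.
     bind_pmf (word_estimate m oP n w) (\<lambda>x.
     map_pmf (\<lambda>y. 1 - min 1 (y / x)) (word_estimate m oQ n w)))"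

text \<open>Pointwise \<open>\<bar>p - q\<bar> = 2 * (p - min p q) - (p - q)\<close>, and the last
  term sums to zero since both masses are one.\<close>

lemma d_TV_eq_sum_min:
  assumes "(\<Sum>w\<in>words \<Sigma> n. pmf P w) = 1" "(\<Sum>w\<in>words \<Sigma> n. pmf Q w) = 1"
  shows "d_TV \<Sigma> n P Q = (\<Sum>w\<in>words \<Sigma> n. pmf P w - min (pmf P w) (pmf Q w))"
proof -
  have "(\<Sum>w\<in>words \<Sigma> n. \<bar>pmf P w - pmf Q w\<bar>) =
      2 * (\<Sum>w\<in>words \<Sigma> n. pmf P w - min (pmf P w) (pmf Q w)) -
      ((\<Sum>w\<in>words \<Sigma> n. pmf P w) - (\<Sum>w\<in>words \<Sigma> n. pmf Q w))"
    unfolding sum_distrib_left sum_subtractf[symmetric] by (intro sum.cong refl) auto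
  then show ?thesis
    by (simp add: assms d_TV_def)
qed

locale two_subcond = P: subcond \<Sigma> n P oP + Q: subcond \<Sigma> n Q oQ
  for \<Sigma> :: "'a set" and n P oP Q oQ
begin

lemma finite_set_trial: "m > 0 \<Longrightarrow> finite (set_pmf (trial m n oP oQ))"
  using P.support finite_subset[OF P.support finite_words[OF P.finite_alphabet]]
  by (auto simp: trial_def P.oracle_prefix_query_Nil intro!: P.word_estimate_moments(1)
      Q.word_estimate_moments(1))

lemma set_trial_subset: "set_pmf (trial m n oP oQ) \<subseteq> {0..1}"
proof -
  have "1 - min 1 (y / x) \<in> {0..1}"
    if "x \<in> set_pmf (word_estimate m oP n w)" "y \<in> set_pmf (word_estimate m oQ n w)" for w x y
    using P.word_estimate_nonneg[OF that(1)] Q.word_estimate_nonneg[OF that(2)] by simp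
  then show ?thesis
    by (auto simp: trial_def)
qed

text \<open>The word is drawn with weight \<open>pmf P w\<close>, and \<open>min_ratio_error\<close>
  absorbs this weight into the absolute errors of the two estimates. Their sums over all words are
  at most \<open>\<eta>\<close> for each oracle.\<close>

lemma expectation_trial:
  assumes "m > 0" "\<eta> > 0" and \<eta>: "(1 + real (card \<Sigma>) / real m) ^ n \<le> 1 + \<eta>\<^sup>2"
  shows "\<bar>measure_pmf.expectation (trial m n oP oQ) (\<lambda>x. x) - d_TV \<Sigma> n P Q\<bar> \<le> 2 * \<eta>"
proof -
  let ?EP = "\<lambda>w. measure_pmf.expectation (word_estimate m oP n w) :: (real \<Rightarrow> real) \<Rightarrow> real"
  let ?EQ = "\<lambda>w. measure_pmf.expectation (word_estimate m oQ n w) :: (real \<Rightarrow> real) \<Rightarrow> real"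
  have fin: "finite (set_pmf (word_estimate m oP n w))" "finite (set_pmf (word_estimate m oQ n w))"
    if "w \<in> words \<Sigma> n" for w
    using P.word_estimate_moments(1) Q.word_estimate_moments(1) that \<open>m > 0\<close> by auto
  have "measure_pmf.expectation (trial m n oP oQ) (\<lambda>x. x) =
      (\<Sum>w\<in>words \<Sigma> n. pmf P w * measure_pmf.expectation (bind_pmf (word_estimate m oP n w) (\<lambda>x.
         map_pmf (\<lambda>y. 1 - min 1 (y / x)) (word_estimate m oQ n w))) (\<lambda>x. x))"
    unfolding trial_def P.oracle_prefix_query_Nil
    using fin P.support finite_words[OF P.finite_alphabet]
    by (subst pmf_expectation_bind[where A = "words \<Sigma> n"]) auto
  also have "\<dots> = (\<Sum>w\<in>words \<Sigma> n. pmf P w * ?EP w (\<lambda>x. ?EQ w (\<lambda>y. 1 - min 1 (y / x))))"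
    using fin by (intro sum.cong refl) (simp add: expectation_bind_pmf_finite)
  finally have E: "measure_pmf.expectation (trial m n oP oQ) (\<lambda>x. x) = \<dots>" .
  have "\<bar>measure_pmf.expectation (trial m n oP oQ) (\<lambda>x. x) - d_TV \<Sigma> n P Q\<bar> \<le>
      (\<Sum>w\<in>words \<Sigma> n. \<bar>pmf P w * ?EP w (\<lambda>x. ?EQ w (\<lambda>y. 1 - min 1 (y / x))) -
        (pmf P w - min (pmf P w) (pmf Q w))\<bar>)"
    unfolding E d_TV_eq_sum_min[OF P.sum_pmf_words Q.sum_pmf_words] sum_subtractf[symmetric]
    by (rule sum_abs)
  also have "\<dots> \<le> (\<Sum>w\<in>words \<Sigma> n. ?EP w (\<lambda>x. \<bar>x - pmf P w\<bar>) + ?EQ w (\<lambda>y. \<bar>y - pmf Q w\<bar>))"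
  proof (rule sum_mono)
    fix w assume w: "w \<in> words \<Sigma> n"
    define p q where "p = pmf P w" and "q = pmf Q w"
    note int = integrable_measure_pmf_finite[OF fin(1)[OF w]]
      integrable_measure_pmf_finite[OF fin(2)[OF w]]
    \<comment> \<open>The true value is moved under both expectations as a constant; then the
      absolute value is pulled in through each of them.\<close>
    have "\<bar>p * ?EP w (\<lambda>x. ?EQ w (\<lambda>y. 1 - min 1 (y / x))) - (p - min p q)\<bar> =
        \<bar>?EP w (\<lambda>x. ?EQ w (\<lambda>y. p * (1 - min 1 (y / x)) - (p - min p q)))\<bar>"
      by (simp add: int)
    also have "\<dots> \<le> ?EP w (\<lambda>x. \<bar>?EQ w (\<lambda>y. p * (1 - min 1 (y / x)) - (p - min p q))\<bar>)"
      by (rule integral_abs_bound)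
    also have "\<dots> \<le> ?EP w (\<lambda>x. ?EQ w (\<lambda>y. \<bar>p * (1 - min 1 (y / x)) - (p - min p q)\<bar>))"
      by (intro expectation_mono_finite fin w integral_abs_bound)
    also have "\<dots> \<le> ?EP w (\<lambda>x. ?EQ w (\<lambda>y. \<bar>x - p\<bar> + \<bar>y - q\<bar>))"
      using P.word_estimate_nonneg Q.word_estimate_nonneg
      by (intro expectation_mono_finite fin w min_ratio_error) (auto simp: p_def q_def)
    also have "\<dots> = ?EP w (\<lambda>x. \<bar>x - p\<bar>) + ?EQ w (\<lambda>y. \<bar>y - q\<bar>)"
      by (simp add: int)
    finally show "\<bar>pmf P w * ?EP w (\<lambda>x. ?EQ w (\<lambda>y. 1 - min 1 (y / x))) -
        (pmf P w - min (pmf P w) (pmf Q w))\<bar> \<le> ?EP w (\<lambda>x. \<bar>x - pmf P w\<bar>) + ?EQ w (\<lambda>y. \<bar>y - pmf Q w\<bar>)"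
      by (simp add: p_def q_def)
  qed
  also have "\<dots> \<le> \<eta> + \<eta>"
    unfolding sum.distrib
    using P.sum_word_estimate_error[OF assms] Q.sum_word_estimate_error[OF assms] by (rule add_mono)
  finally show ?thesis by simp
qed

end

section \<open>Testers realizing the estimates\<close>

definition frequency_tester ::
    "nat \<Rightarrow> (('a list \<Rightarrow> 'a tester) \<Rightarrow> 'a tester) \<Rightarrow> nat \<Rightarrow> 'a \<Rightarrow> (real \<Rightarrow> 'a tester) \<Rightarrow> 'a tester" where
  "frequency_tester m c i a = (\<lambda>k.
     fold_tester (+) 0 (replicate m (\<lambda>k. c (\<lambda>v. k (of_bool (v ! i = a))))) (\<lambda>x. k (x / real m)))"

lemma implements_frequency:
  assumes "implements oP oQ 1 c D"
  shows "implements oP oQ m (frequency_tester m c i a) (frequency m D i a)"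
proof -
  have "list_all2 (implements oP oQ 1) (replicate m (\<lambda>k. c (\<lambda>v. k (of_bool (v ! i = a) :: real))))
      (replicate m (map_pmf (\<lambda>v. of_bool (v ! i = a)) D))"
    using implements_map[OF assms, of "\<lambda>v. of_bool (v ! i = a) :: real"] by (simp add: list_all2_conv_all_nth)
  from implements_map[OF implements_fold[OF this, of "(+)" 0], of "\<lambda>x. x / real m"] show ?thesis
    by (simp add: frequency_tester_def frequency_def)
qed

text \<open>The parameter \<open>c\<close> stands for \<open>Query_P\<close> or
  \<open>Query_Q\<close>, so one construction serves both oracles.\<close>

definition word_tester ::
    "nat \<Rightarrow> ('a query \<Rightarrow> ('a list \<Rightarrow> 'a tester) \<Rightarrow> 'a tester) \<Rightarrow> nat \<Rightarrow> 'a list \<Rightarrow>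
      (real \<Rightarrow> 'a tester) \<Rightarrow> 'a tester" where
  "word_tester m c n w = fold_tester (*) 1
     (map (\<lambda>i. frequency_tester m (c (prefix_query n (take i w))) i (w ! i)) [0..<n])"

lemma implements_word:
  assumes "\<And>\<rho>. implements oP oQ 1 (c \<rho>) (orc \<rho>)"
  shows "implements oP oQ (n * m) (word_tester m c n w) (word_estimate m orc n w)"
proof -
  have "list_all2 (implements oP oQ m)
      (map (\<lambda>i. frequency_tester m (c (prefix_query n (take i w))) i (w ! i)) [0..<n])
      (map (\<lambda>i. frequency m (orc (prefix_query n (take i w))) i (w ! i)) [0..<n])"
    by (auto simp: list_all2_conv_all_nth intro!: implements_frequency assms)
  from implements_fold[OF this] show ?thesis
    by (simp add: word_tester_def word_estimate_def)
qed

definition trial_tester :: "nat \<Rightarrow> nat \<Rightarrow> (real \<Rightarrow> 'a tester) \<Rightarrow> 'a tester" where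
  "trial_tester m n = (\<lambda>k.
     Query_P (prefix_query n []) (\<lambda>w.
     word_tester m Query_P n w (\<lambda>x.
     word_tester m Query_Q n w (\<lambda>y. k (1 - min 1 (y / x))))))"

text \<open>One query draws the word, and \<open>n * m\<close> queries go into each of its two
  estimates.\<close>

lemma implements_trial:
  "implements oP oQ (1 + 2 * n * m) (trial_tester m n) (trial m n oP oQ)"
proof -
  have "implements oP oQ (1 + (n * m + n * m)) (trial_tester m n) (trial m n oP oQ)"
    unfolding trial_tester_def trial_def
    by (intro implements_bind implements_map implements_word implements_Query_P implements_Query_Q)
  then show ?thesis
    by (simp add: mult_2 distrib_right)
qed

definition distance_tester :: "nat \<Rightarrow> nat \<Rightarrow> nat \<Rightarrow> real \<Rightarrow> 'a tester" where
  "distance_tester T m n \<theta> = fold_tester (+) 0 (replicate T (trial_tester m n))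
     (\<lambda>s. Output (if s / real T \<le> \<theta> then Accept else Reject))"

lemma run_distance_tester:
  "run oP oQ (distance_tester T m n \<theta>) =
     map_pmf (\<lambda>x. (if x \<le> \<theta> then Accept else Reject, T * (1 + 2 * n * m)))
       (map_pmf (\<lambda>s. s / real T) (fold_pmf (+) 0 (replicate T (trial m n oP oQ))))"
proof -
  have "list_all2 (implements oP oQ (1 + 2 * n * m)) (replicate T (trial_tester m n))
      (replicate T (trial m n oP oQ))"
    using implements_trial[of oP oQ n m] by (simp add: list_all2_conv_all_nth)
  from implements_fold[OF this, of "(+)" "0"] show ?thesis
    by (simp add: implements_def distance_tester_def map_pmf_def bind_assoc_pmf bind_return_pmf)
qed

section \<open>Parameters, concentration and query count\<close>

text \<open>With \<open>z = \<delta>\<^sup>2 / 128\<close>, the power is at most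
  \<open>exp z\<close>, hence at most \<open>1 + 2 * z\<close>, which is the right-hand
  side.\<close>

lemma one_plus_divide_power_le:
  fixes s \<delta> :: real
  assumes "s \<ge> 0" "0 < \<delta>" "\<delta> \<le> 1" "m > 0" "128 * real n * s / \<delta>\<^sup>2 \<le> real m"
  shows "(1 + s / real m) ^ n \<le> 1 + (\<delta> / 8)\<^sup>2"
proof -
  define z where "z = \<delta>\<^sup>2 / 128"
  have "\<delta>\<^sup>2 \<le> 1"
    using assms by (simp add: power_le_one)
  then have z: "0 \<le> z" "z \<le> 1"
    by (auto simp: z_def)
  have "(1 + s / real m) ^ n \<le> exp (s / real m) ^ n"
    using assms by (intro power_mono exp_ge_add_one_self) auto
  also have "\<dots> = exp (real n * (s / real m))"
    by (rule exp_of_nat_mult[symmetric])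
  also have "\<dots> \<le> exp z"
    using assms by (simp add: z_def field_simps)
  also have "\<dots> \<le> 1 + z + z\<^sup>2"
    using z by (rule exp_bound)
  also have "\<dots> \<le> 1 + z + z"
    using z by (simp add: power2_eq_square mult_left_le)
  also have "\<dots> = 1 + (\<delta> / 8)\<^sup>2"
    by (simp add: z_def power_divide)
  finally show ?thesis .
qed

context two_subcond
begin

text \<open>The error budget \<open>\<delta> / 2\<close> is split evenly: at most
  \<open>\<delta> / 4\<close> of bias from the estimates and less than \<open>\<delta> / 4\<close>
  of deviation by Chebyshev's inequality.\<close>

lemma average_trial_concentration:
  assumes "0 < \<delta>" "\<delta> \<le> 1" and T: "T > 0" "40 / \<delta>\<^sup>2 \<le> real T"
    and m: "m > 0" "128 * real n * real (card \<Sigma>) / \<delta>\<^sup>2 \<le> real m"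
  defines "A \<equiv> map_pmf (\<lambda>s. s / real T) (fold_pmf (+) 0 (replicate T (trial m n oP oQ)))"
  shows "measure_pmf.prob A {x. \<bar>x - d_TV \<Sigma> n P Q\<bar> < \<delta> / 2} \<ge> 3 / 5"
proof -
  let ?M = "trial m n oP oQ"
  define \<mu> where "\<mu> = measure_pmf.expectation ?M (\<lambda>x. x)"
  have fin: "finite (set_pmf ?M)"
    using m by (intro finite_set_trial)
  note avg = expectation_average[OF fin \<open>T > 0\<close>, folded A_def \<mu>_def]
  \<comment> \<open>A trial's outcome lies in the unit interval, so its second moment is at most
    one.\<close>
  have "measure_pmf.variance ?M (\<lambda>x. x) \<le> measure_pmf.expectation ?M (\<lambda>x. x\<^sup>2)"
    by (simp add: measure_pmf.variance_eq integrable_measure_pmf_finite[OF fin])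
  also have "\<dots> \<le> measure_pmf.expectation ?M (\<lambda>x. 1)"
    using set_trial_subset[of m] by (intro expectation_mono_finite fin) (auto intro!: power_le_one)
  finally have var: "measure_pmf.variance A (\<lambda>x. x) \<le> 1 / real T"
    using avg(2) T by (simp add: \<mu>_def divide_right_mono)
  have "measure_pmf.prob A {x \<in> space A. \<delta> / 4 \<le> \<bar>x - measure_pmf.expectation A (\<lambda>x. x)\<bar>} \<le>
      measure_pmf.variance A (\<lambda>x. x) / (\<delta> / 4)\<^sup>2"
    using assms by (intro measure_pmf.Chebyshev_inequality integrable_measure_pmf_finite avg) auto
  also have "\<dots> \<le> (1 / real T) / (\<delta> / 4)\<^sup>2"
    by (intro divide_right_mono var) auto
  \<comment> \<open>By the choice of \<open>T\<close> the bound
    \<open>16 / (T * \<delta>\<^sup>2)\<close> is at most \<open>16 / 40\<close>.\<close>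
  also have "\<dots> \<le> 2 / 5"
    using assms by (simp add: field_simps)
  finally have tail: "measure_pmf.prob A {x. \<delta> / 4 \<le> \<bar>x - \<mu>\<bar>} \<le> 2 / 5"
    by (simp add: avg)
  \<comment> \<open>Taking \<open>\<eta> = \<delta> / 8\<close> makes the bias
    \<open>2 * \<eta>\<close> fit its share.\<close>
  have "(1 + real (card \<Sigma>) / real m) ^ n \<le> 1 + (\<delta> / 8)\<^sup>2"
    using assms by (intro one_plus_divide_power_le) auto
  then have bias: "\<bar>\<mu> - d_TV \<Sigma> n P Q\<bar> \<le> \<delta> / 4"
    using expectation_trial[of m "\<delta> / 8"] assms by (simp add: \<mu>_def)
  have "3 / 5 \<le> measure_pmf.prob A (- {x. \<delta> / 4 \<le> \<bar>x - \<mu>\<bar>})"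
    using tail measure_pmf.prob_compl[of "{x. \<delta> / 4 \<le> \<bar>x - \<mu>\<bar>}" A] by (simp add: Compl_eq_Diff_UNIV)
  also have "\<bar>x - d_TV \<Sigma> n P Q\<bar> < \<delta> / 2" if "\<not> \<delta> / 4 \<le> \<bar>x - \<mu>\<bar>" for x
    using bias that by linarith
  then have "measure_pmf.prob A (- {x. \<delta> / 4 \<le> \<bar>x - \<mu>\<bar>}) \<le>
      measure_pmf.prob A {x. \<bar>x - d_TV \<Sigma> n P Q\<bar> < \<delta> / 2}"
    by (intro measure_pmf.finite_measure_mono) auto
  finally show ?thesis .
qed

end

text \<open>The summands \<open>1\<close> in the hypotheses come from rounding up. As
  \<open>1 / \<delta>\<^sup>2\<close> and \<open>r\<close> are at least one, they raise 40 to 41 and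
  128 to 129; then \<open>259 = 2 * 129 + 1\<close> and \<open>10619 = 41 * 259\<close>.\<close>

lemma query_count_le:
  fixes n s :: nat and \<delta> :: real
  assumes "n > 0" "s > 0" "0 < \<delta>" "\<delta> \<le> 1"
    and T: "real T \<le> 40 / \<delta>\<^sup>2 + 1" and m: "real m \<le> 128 * real n * real s / \<delta>\<^sup>2 + 1"
  shows "real (T * (1 + 2 * n * m)) \<le> 10619 * (real n ^ 3 * real s / \<delta> ^ 5)"
proof -
  define r where "r = real n * real s / \<delta>\<^sup>2"
  have sq: "0 < \<delta>\<^sup>2" "\<delta>\<^sup>2 \<le> 1"
    using assms by (auto simp: power_le_one)
  have ns: "1 \<le> real n" "1 \<le> real s"
    using assms by auto
  have "1 \<le> real n * real s"
    using mult_mono[of 1 "real n" 1 "real s"] ns by simp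
  then have r: "1 \<le> r"
    using sq by (simp add: r_def)
  have nr: "1 \<le> real n * r"
    using mult_mono[of 1 "real n" 1 r] ns r by simp
  have T': "real T \<le> 41 / \<delta>\<^sup>2"
    using T sq by (simp add: field_simps)
  have "real m \<le> 129 * r"
    using m r by (simp add: r_def)
  then have "real n * real m \<le> real n * (129 * r)"
    by (intro mult_left_mono) auto
  then have "1 + 2 * real n * real m \<le> 259 * (real n * r)"
    using nr by (simp only: mult.assoc mult.left_commute[of _ 129])
  then have "real (T * (1 + 2 * n * m)) \<le> (41 / \<delta>\<^sup>2) * (259 * (real n * r))"
    unfolding of_nat_mult of_nat_add of_nat_1 of_nat_numeral
    using T' sq by (intro mult_mono) auto
  also have "\<dots> = 10619 * (real n ^ 2 * real s / \<delta> ^ 4)"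
    by (simp add: r_def power2_eq_square power4_eq_xxxx)
  \<comment> \<open>Only here is the sharper bound weakened to the claimed rate, by
    \<open>n \<ge> 1\<close> and \<open>\<delta> \<le> 1\<close>.\<close>
  also have "real n ^ 2 * real s / \<delta> ^ 4 \<le> real n ^ 3 * real s / \<delta> ^ 5"
    using assms ns by (intro frac_le mult_right_mono power_increasing power_decreasing) auto
  finally show ?thesis by simp
qed

section \<open>The tester and its guarantees\<close>

theorem theorem2:
  "\<exists>(A :: 'a set \<Rightarrow> nat \<Rightarrow> real \<Rightarrow> real \<Rightarrow> 'a tester) (C :: real) (c :: nat).
     \<forall>\<Sigma> n \<epsilon>\<^sub>1 \<epsilon>\<^sub>2 P Q oP oQ.
       finite \<Sigma> \<longrightarrow> 0 < \<epsilon>\<^sub>2 \<longrightarrow> \<epsilon>\<^sub>2 \<le> 1 \<longrightarrow> 0 \<le> \<epsilon>\<^sub>1 \<longrightarrow> \<epsilon>\<^sub>1 < \<epsilon>\<^sub>2 \<longrightarrow>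
       set_pmf P \<subseteq> words \<Sigma> n \<longrightarrow> set_pmf Q \<subseteq> words \<Sigma> n \<longrightarrow>
       subcond_oracle \<Sigma> n P oP \<longrightarrow> subcond_oracle \<Sigma> n Q oQ \<longrightarrow>
         (\<forall>(v, q) \<in> set_pmf (run oP oQ (A \<Sigma> n \<epsilon>\<^sub>1 \<epsilon>\<^sub>2)).
            real q \<le> C * soft (query_rate \<Sigma> n \<epsilon>\<^sub>1 \<epsilon>\<^sub>2) c) \<and>
         (d_TV \<Sigma> n P Q < \<epsilon>\<^sub>1 \<longrightarrow> verdict_prob oP oQ (A \<Sigma> n \<epsilon>\<^sub>1 \<epsilon>\<^sub>2) Accept \<ge> 3 / 5) \<and>
         (d_TV \<Sigma> n P Q > \<epsilon>\<^sub>2 \<longrightarrow> verdict_prob oP oQ (A \<Sigma> n \<epsilon>\<^sub>1 \<epsilon>\<^sub>2) Reject \<ge> 3 / 5)"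
proof -
  define T :: "real \<Rightarrow> nat" where "T = (\<lambda>\<delta>. nat \<lceil>40 / \<delta>\<^sup>2\<rceil>)"
  define m :: "'a set \<Rightarrow> nat \<Rightarrow> real \<Rightarrow> nat"
    where "m = (\<lambda>\<Sigma> n \<delta>. nat \<lceil>128 * real n * real (card \<Sigma>) / \<delta>\<^sup>2\<rceil>)"
  \<comment> \<open>For \<open>n = 0\<close> the query rate vanishes, so the tester must answer
    without queries. Otherwise the threshold is the midpoint, at distance
    \<open>\<delta> / 2\<close> from both parameters.\<close>
  define A :: "'a set \<Rightarrow> nat \<Rightarrow> real \<Rightarrow> real \<Rightarrow> 'a tester"
    where "A = (\<lambda>\<Sigma> n \<epsilon>\<^sub>1 \<epsilon>\<^sub>2. if n = 0 then Output Accept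
      else distance_tester (T (\<epsilon>\<^sub>2 - \<epsilon>\<^sub>1)) (m \<Sigma> n (\<epsilon>\<^sub>2 - \<epsilon>\<^sub>1)) n ((\<epsilon>\<^sub>1 + \<epsilon>\<^sub>2) / 2))"
  \<comment> \<open>The exponent 0 in \<open>soft\<close> means that no logarithmic factor is
    spent.\<close>
  have "(\<forall>(v, q) \<in> set_pmf (run oP oQ (A \<Sigma> n \<epsilon>\<^sub>1 \<epsilon>\<^sub>2)).
          real q \<le> 10619 * soft (query_rate \<Sigma> n \<epsilon>\<^sub>1 \<epsilon>\<^sub>2) 0) \<and>
      (d_TV \<Sigma> n P Q < \<epsilon>\<^sub>1 \<longrightarrow> verdict_prob oP oQ (A \<Sigma> n \<epsilon>\<^sub>1 \<epsilon>\<^sub>2) Accept \<ge> 3 / 5) \<and>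
      (d_TV \<Sigma> n P Q > \<epsilon>\<^sub>2 \<longrightarrow> verdict_prob oP oQ (A \<Sigma> n \<epsilon>\<^sub>1 \<epsilon>\<^sub>2) Reject \<ge> 3 / 5)"
    if asms: "finite \<Sigma>" "0 < \<epsilon>\<^sub>2" "\<epsilon>\<^sub>2 \<le> 1" "0 \<le> \<epsilon>\<^sub>1" "\<epsilon>\<^sub>1 < \<epsilon>\<^sub>2"
      "set_pmf P \<subseteq> words \<Sigma> n" "set_pmf Q \<subseteq> words \<Sigma> n"
      "subcond_oracle \<Sigma> n P oP" "subcond_oracle \<Sigma> n Q oQ"
    for \<Sigma> :: "'a set" and n \<epsilon>\<^sub>1 \<epsilon>\<^sub>2 P Q oP oQ
  proof -
    interpret two_subcond \<Sigma> n P oP Q oQ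
      by unfold_locales (use asms in auto)
    show ?thesis
    proof (cases "n = 0")
      case True
      \<comment> \<open>Both distributions are concentrated on the empty word, so their distance is
        zero and accepting is right.\<close>
      have "words \<Sigma> 0 = {[]}"
        by (auto simp: words_def)
      then have "d_TV \<Sigma> n P Q = 0"
        using P.sum_pmf_words Q.sum_pmf_words True by (simp add: d_TV_def)
      then show ?thesis
        using True asms by (simp add: A_def verdict_prob_def soft_def query_rate_def)
    next
      case False
      define \<delta> where "\<delta> = \<epsilon>\<^sub>2 - \<epsilon>\<^sub>1"
      have \<delta>: "0 < \<delta>" "\<delta> \<le> 1"
        using asms by (auto simp: \<delta>_def)
      \<comment> \<open>The support of \<open>P\<close> forces a nonempty alphabet, which makes the
        sample size \<open>m\<close> positive.\<close>
      have "words \<Sigma> n \<noteq> {}"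
        using P.support set_pmf_not_empty[of P] by auto
      then have "\<Sigma> \<noteq> {}"
        using False by (auto simp: words_def)
      then have card: "card \<Sigma> > 0"
        using asms by (simp add: card_gt_0_iff)
      have T: "T \<delta> > 0" "40 / \<delta>\<^sup>2 \<le> real (T \<delta>)" "real (T \<delta>) \<le> 40 / \<delta>\<^sup>2 + 1"
        using \<delta> by (auto simp: T_def real_nat_ceiling_ge of_nat_ceiling)
      have m: "m \<Sigma> n \<delta> > 0" "128 * real n * real (card \<Sigma>) / \<delta>\<^sup>2 \<le> real (m \<Sigma> n \<delta>)"
        "real (m \<Sigma> n \<delta>) \<le> 128 * real n * real (card \<Sigma>) / \<delta>\<^sup>2 + 1"
        using \<delta> card False by (auto simp: m_def real_nat_ceiling_ge of_nat_ceiling)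
      define S where "S = map_pmf (\<lambda>s. s / real (T \<delta>))
        (fold_pmf (+) 0 (replicate (T \<delta>) (trial (m \<Sigma> n \<delta>) n oP oQ)))"
      have run: "run oP oQ (A \<Sigma> n \<epsilon>\<^sub>1 \<epsilon>\<^sub>2) =
          map_pmf (\<lambda>x. (if x \<le> (\<epsilon>\<^sub>1 + \<epsilon>\<^sub>2) / 2 then Accept else Reject,
            T \<delta> * (1 + 2 * n * m \<Sigma> n \<delta>))) S"
        using False by (simp add: A_def S_def run_distance_tester \<delta>_def[symmetric] del: pmf.map_comp)
      have S: "measure_pmf.prob S {x. \<bar>x - d_TV \<Sigma> n P Q\<bar> < \<delta> / 2} \<ge> 3 / 5"
        unfolding S_def using \<delta> T m by (intro average_trial_concentration)
      have verdict: "verdict_prob oP oQ (A \<Sigma> n \<epsilon>\<^sub>1 \<epsilon>\<^sub>2) v \<ge> 3 / 5"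
        if "\<And>x. \<bar>x - d_TV \<Sigma> n P Q\<bar> < \<delta> / 2 \<Longrightarrow> (if x \<le> (\<epsilon>\<^sub>1 + \<epsilon>\<^sub>2) / 2 then Accept else Reject) = v"
        for v
        unfolding verdict_prob_def run measure_map_pmf
        by (intro order_trans[OF S] measure_pmf.finite_measure_mono subsetI) (use that in simp_all)
      have "verdict_prob oP oQ (A \<Sigma> n \<epsilon>\<^sub>1 \<epsilon>\<^sub>2) Accept \<ge> 3 / 5" if "d_TV \<Sigma> n P Q < \<epsilon>\<^sub>1"
      proof (rule verdict)
        fix x assume "\<bar>x - d_TV \<Sigma> n P Q\<bar> < \<delta> / 2"
        \<comment> \<open>An estimate within \<open>\<delta> / 2\<close> of a distance below
          \<open>\<epsilon>\<^sub>1\<close> stays below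
          \<open>\<epsilon>\<^sub>1 + \<delta> / 2\<close>, the midpoint.\<close>
        then have "x \<le> (\<epsilon>\<^sub>1 + \<epsilon>\<^sub>2) / 2"
          using that unfolding \<delta>_def by argo
        then show "(if x \<le> (\<epsilon>\<^sub>1 + \<epsilon>\<^sub>2) / 2 then Accept else Reject) = Accept"
          by simp
      qed
      moreover have "verdict_prob oP oQ (A \<Sigma> n \<epsilon>\<^sub>1 \<epsilon>\<^sub>2) Reject \<ge> 3 / 5" if "d_TV \<Sigma> n P Q > \<epsilon>\<^sub>2"
      proof (rule verdict)
        fix x assume "\<bar>x - d_TV \<Sigma> n P Q\<bar> < \<delta> / 2"
        then have "\<not> x \<le> (\<epsilon>\<^sub>1 + \<epsilon>\<^sub>2) / 2"
          using that unfolding \<delta>_def by argo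
        then show "(if x \<le> (\<epsilon>\<^sub>1 + \<epsilon>\<^sub>2) / 2 then Accept else Reject) = Reject"
          by simp
      qed
      moreover have "real (T \<delta> * (1 + 2 * n * m \<Sigma> n \<delta>)) \<le> 10619 * soft (query_rate \<Sigma> n \<epsilon>\<^sub>1 \<epsilon>\<^sub>2) 0"
        using query_count_le[of n "card \<Sigma>" \<delta> "T \<delta>" "m \<Sigma> n \<delta>"] False card \<delta> T m
        by (simp add: soft_def query_rate_def \<delta>_def)
      ultimately show ?thesis
        by (simp add: run)
    qed
  qed
  then show ?thesis
    by (intro exI[of _ A] exI[of _ 10619] exI[of _ 0] allI impI)
qed

end
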